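(* Let $m \geq 2$ and $k \geq 2$ be integers, and let $T$ be a perfect $m$-ary tree rooted at $r$ of depth $d > \frac{3k}{2}$. Let $q$ be the unique integer with $d \equiv q \pmod{k}$ and $\frac{k}{2} \leq q < \frac{3k}{2}$, and let $T_q$ be the perfect $m$-ary subtree of $T$ rooted at $r$ of depth $q$. Then \[\gamma_{all,k}^\infty(T) = \frac{m^d-m^q}{m^k-1}+\gamma_{all,k}^\infty(T_q).\]
   Context: A perfect $m$-ary tree of depth $d$ is a rooted tree in which every non-leaf vertex has exactly $m$ children and every leaf is at distance exactly $d$ from the root. Graphs are finite and simple; $d(u,v)$ is graph distance and $N_k[x]=\{v: d(x,v)\le k\}$. A multiset $D$ of vertices of $G$ is a distance-$k$ dominating set if every vertex of $V(G)\setminus D$ is at distance at most $k$ from some element of $D$. Let $\mathbb{D}_{k,q}(G)$ be the set of such multisets of cardinality $q$. $D=\{v_1,\dots,v_q\}$ transforms to $D'=\{u_1,\dots,u_q\}$ if (for some indexing) $u_i\in N_k[v_i]$ for all $i$. An eternal distance-$k$ dominating family is $\mathcal{E}\subseteq\mathbb{D}_{k,q}(G)$ for some $q$ such that for every $D\in\mathcal{E}$ and every vertex $v$ there is $D'\in\mathcal{E}$ with $v\in D'$ and $D$ transforms to $D'$. $\gamma_{all,k}^\infty(G)$ is the minimum $q$ for which such a family exists. *)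

theory Defs
  imports
    "Graph_Theory.Graph_Theory"
    "HOL-Library.Multiset"
    "HOL-Number_Theory.Cong"
begin

text \<open>
  A finite simple graph is a \<open>pair_graph\<close>: a finite vertex set with a symmetric, irreflexive
  set of arcs, each undirected edge being represented by its two orientations.
\<close>

definition gdist :: "'a pair_pre_digraph \<Rightarrow> 'a \<Rightarrow> 'a \<Rightarrow> ereal" where
  "gdist G u v = wf_digraph.\<mu> (with_proj G) (\<lambda>_. 1) u v"

definition nbhd :: "'a pair_pre_digraph \<Rightarrow> nat \<Rightarrow> 'a \<Rightarrow> 'a set" where
  "nbhd G k x = {v \<in> pverts G. gdist G x v \<le> ereal (real k)}"

definition dist_dominating :: "'a pair_pre_digraph \<Rightarrow> nat \<Rightarrow> 'a multiset \<Rightarrow> bool" where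
  "dist_dominating G k D \<longleftrightarrow> set_mset D \<subseteq> pverts G \<and>
     (\<forall>v \<in> pverts G - set_mset D. \<exists>u \<in> set_mset D. gdist G v u \<le> ereal (real k))"

definition dominating_multisets :: "nat \<Rightarrow> nat \<Rightarrow> 'a pair_pre_digraph \<Rightarrow> 'a multiset set" where
  "dominating_multisets k q G = {D. dist_dominating G k D \<and> size D = q}"

text \<open>
  \<open>rel_mset R D D'\<close> says that \<open>D\<close> and \<open>D'\<close> can be listed as \<open>v\<^sub>1, \<dots>, v\<^sub>q\<close> and \<open>u\<^sub>1, \<dots>, u\<^sub>q\<close>
  such that \<open>R v\<^sub>i u\<^sub>i\<close> holds for every \<open>i\<close>.
\<close>

definition transforms :: "'a pair_pre_digraph \<Rightarrow> nat \<Rightarrow> 'a multiset \<Rightarrow> 'a multiset \<Rightarrow> bool" where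
  "transforms G k D D' \<longleftrightarrow> rel_mset (\<lambda>v u. u \<in> nbhd G k v) D D'"

text \<open>
  Families are required to be nonempty: the empty family satisfies the closure condition
  vacuously for every \<open>q\<close>, including \<open>0\<close>.
\<close>

definition eternal_dominating_family ::
    "'a pair_pre_digraph \<Rightarrow> nat \<Rightarrow> nat \<Rightarrow> 'a multiset set \<Rightarrow> bool" where
  "eternal_dominating_family G k q \<E> \<longleftrightarrow>
     \<E> \<noteq> {} \<and> \<E> \<subseteq> dominating_multisets k q G \<and>
     (\<forall>D \<in> \<E>. \<forall>v \<in> pverts G. \<exists>D' \<in> \<E>. v \<in># D' \<and> transforms G k D D')"

text \<open>
  The minimum exists for every finite graph: for \<open>q = card (pverts G)\<close> the family
  \<open>{mset_set (pverts G)}\<close> qualifies.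
\<close>

definition gamma_all :: "nat \<Rightarrow> 'a pair_pre_digraph \<Rightarrow> nat" where
  "gamma_all k G = (LEAST q. \<exists>\<E>. eternal_dominating_family G k q \<E>)"

text \<open>
  The library predicate \<open>tree\<close> does not fit symmetric digraphs, because it counts a closed walk
  \<open>u, v, u\<close> along a single edge as a cycle; cycles of an undirected graph have length at least 3.
\<close>

definition undirected_tree :: "'a pair_pre_digraph \<Rightarrow> bool" where
  "undirected_tree G \<longleftrightarrow> pair_graph G \<and> Digraph_Component.connected (with_proj G) \<and>
     \<not> (\<exists>p. pre_digraph.cycle (with_proj G) p \<and> 3 \<le> length p)"

definition children :: "'a pair_pre_digraph \<Rightarrow> 'a \<Rightarrow> 'a \<Rightarrow> 'a set" where
  "children G r v = {w. (v, w) \<in> parcs G \<and> gdist G r w = gdist G r v + 1}"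

definition rooted_leaf :: "'a pair_pre_digraph \<Rightarrow> 'a \<Rightarrow> 'a \<Rightarrow> bool" where
  "rooted_leaf G r v \<longleftrightarrow> v \<in> pverts G \<and> children G r v = {}"

definition perfect_tree :: "nat \<Rightarrow> nat \<Rightarrow> 'a \<Rightarrow> 'a pair_pre_digraph \<Rightarrow> bool" where
  "perfect_tree m d r G \<longleftrightarrow> undirected_tree G \<and> r \<in> pverts G \<and>
     (\<forall>v \<in> pverts G. \<not> rooted_leaf G r v \<longrightarrow> card (children G r v) = m) \<and>
     (\<forall>v. rooted_leaf G r v \<longrightarrow> gdist G r v = ereal (real d))"

end

theory Submission
  imports Defs
begin

text \<open>
  Let \<open>T\<^sub>n\<close> be the perfect tree of depth \<open>n\<close>. It suffices that
  \<open>\<gamma>(T\<^bsub>n+k\<^esub>) = m\<^sup>n + \<gamma>(T\<^sub>n)\<close> for every \<open>n\<close>. Let \<open>L\<close> be the set of the \<open>m\<^sup>n\<close> vertices of depth \<open>n\<close>.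

  For \<open>\<le>\<close>, play an eternal strategy on \<open>T\<^sub>n\<close> and keep one additional guard on each vertex of \<open>L\<close>.
  An attack below \<open>x \<in> L\<close> is answered by the guard on \<open>x\<close> while the strategy on \<open>T\<^sub>n\<close> brings a guard
  to \<open>x\<close>; at the next attack the guard below \<open>x\<close> returns to \<open>x\<close>.

  For \<open>\<ge>\<close>, every configuration has a guard at or below each \<open>x \<in> L\<close>, as the leaves below \<open>x\<close> must be
  reached from there. Project all guards to \<open>T\<^sub>n\<close> and drop one guard on each vertex of \<open>L\<close>. A move
  \<open>a \<rightarrow> x \<rightarrow> y\<close> passing through a dropped guard on \<open>x\<close> is contracted to \<open>a \<rightarrow> y\<close>: as \<open>x\<close> has maximal
  depth in \<open>T\<^sub>n\<close>, the distance from \<open>a\<close> to \<open>y\<close> is at most the larger of the distances from \<open>a\<close> to \<open>x\<close> and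
  from \<open>x\<close> to \<open>y\<close>. Two guards are present at or below \<open>x\<close> after an attack on a leaf below \<open>x\<close>, because
  this leaf is farther than \<open>k\<close> from a leaf below another child of \<open>x\<close>; so attacks on \<open>x\<close> itself
  are answered too.
\<close>

subsection \<open>Eternal families on words\<close>


text \<open>Domination is not demanded separately: any vertex may be attacked, and the guard
  answering comes from the current configuration. An arbitrary relation \<open>R\<close> allows
  transfer along bijections.\<close>

definition eternal :: "'a set \<Rightarrow> ('a \<Rightarrow> 'a \<Rightarrow> bool) \<Rightarrow> nat \<Rightarrow> 'a multiset set \<Rightarrow> bool" where
  "eternal V R q \<E> \<longleftrightarrow> \<E> \<noteq> {} \<and>
     (\<forall>D\<in>\<E>. set_mset D \<subseteq> V \<and> size D = q \<and> (\<forall>v\<in>V. \<exists>D'\<in>\<E>. v \<in># D' \<and> rel_mset R D D'))"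

definition words :: "nat \<Rightarrow> nat \<Rightarrow> nat list set" where
  "words m d = {u. set u \<subseteq> {..<m} \<and> length u \<le> d}"

text \<open>
  A vertex of the perfect tree is the word of child indices leading to it from the root. The witness
  \<open>i\<close> is the length of any common prefix, since the longest one gives the distance
  \<open>length u + length v - 2 * i\<close>.
\<close>

definition near :: "nat \<Rightarrow> nat list \<Rightarrow> nat list \<Rightarrow> bool" where
  "near k u v \<longleftrightarrow> (\<exists>i. i \<le> length u \<and> i \<le> length v \<and> take i u = take i v \<and> length u + length v \<le> k + 2 * i)"

lemma near_refl [simp]: "near k u u"
  unfolding near_def by (rule exI[of _ "length u"]) simp

lemma near_sym: "near k u v \<Longrightarrow> near k v u"
  unfolding near_def by (metis add.commute)

text \<open>Truncation is the projection to the upper tree. If the common prefix is longer than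
  \<open>n\<close>, both words are cut to the same word.\<close>

lemma near_take: "near k u v \<Longrightarrow> near k (take n u) (take n v)"
proof -
  assume "near k u v"
  then obtain i where i: "i \<le> length u" "i \<le> length v" "take i u = take i v" "length u + length v \<le> k + 2 * i"
    unfolding near_def by auto
  have "take (min i n) u = take (min i n) v"
    using i(3) by (metis take_take min.commute)
  with i show ?thesis
    unfolding near_def by (intro exI[of _ "min i n"]) (auto simp: min_def)
qed

lemma near_take_self: "length u \<le> n + k \<Longrightarrow> near k u (take n u)"
  unfolding near_def by (rule exI[of _ "min n (length u)"]) (auto simp: min_def)

text \<open>
  The paths from \<open>a\<close> and \<open>y\<close> to \<open>x\<close> meet the path from the root to \<open>x\<close> in two ancestors of \<open>x\<close>;
  as \<open>x\<close> is at least as deep as \<open>a\<close> and \<open>y\<close>, the one attached to the lower ancestor is no farther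
  from that ancestor than \<open>x\<close> is.
\<close>

lemma near_trans_deep:
  assumes "near k a x" "near k x y" "length a \<le> length x" "length y \<le> length x"
  shows "near k a y"
proof -
  obtain i where i: "i \<le> length a" "i \<le> length x" "take i a = take i x" "length a + length x \<le> k + 2 * i"
    using assms(1) unfolding near_def by auto
  obtain j where j: "j \<le> length x" "j \<le> length y" "take j x = take j y" "length x + length y \<le> k + 2 * j"
    using assms(2) unfolding near_def by auto
  have "take (min i j) a = take (min i j) y"
    using i(3) j(3) by (metis take_take min.commute)
  with i j assms(3,4) show ?thesis
    unfolding near_def by (intro exI[of _ "min i j"]) (auto simp: min_def)
qed

text \<open>From a leaf of depth \<open>n + k\<close>, \<open>k\<close> steps lead up to depth
  \<open>n\<close> at best, so the ancestor at depth \<open>n\<close> is never left.\<close>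

lemma near_leaf_take_eq:
  assumes "near k u w" "length w = n + k"
  shows "take n u = take n w"
proof -
  obtain i where i: "i \<le> length u" "i \<le> length w" "take i u = take i w" "length u + length w \<le> k + 2 * i"
    using assms(1) unfolding near_def by auto
  then have "n \<le> i" using assms(2) by linarith
  then show ?thesis using i(3) by (metis take_take min.absorb1)
qed

text \<open>The two words branch at \<open>x\<close>, so their distance is
  \<open>2 * k\<close>.\<close>

lemma not_near_siblings:
  assumes "k \<ge> 1"
  shows "\<not> near k (x @ replicate k (0::nat)) (x @ replicate k 1)"
proof
  assume "near k (x @ replicate k 0) (x @ replicate k 1)"
  then obtain i where i: "take i (x @ replicate k 0) = take i (x @ replicate k 1)"
      "i \<le> length x + k" "2 * (length x + k) \<le> k + 2 * i"
    unfolding near_def by (auto simp del: take_append)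
  have "i > length x" using i(3) assms by (simp add: algebra_simps)
  then have "take i (x @ replicate k 0) ! length x = 0" "take i (x @ replicate k 1) ! length x = 1"
    using i(2) by (auto simp: nth_append)
  then show False unfolding i(1) by simp
qed

section \<open>Matchings of multisets\<close>

lemma rel_mset_add_refl:
  assumes "\<And>x. R x x" "rel_mset R A B"
  shows "rel_mset R (L + A) (L + B)"
  using assms by (induction L) (auto intro: rel_mset_Plus)

lemma rel_mset_self: "(\<And>x. R x x) \<Longrightarrow> rel_mset R A A"
  using rel_mset_add_refl[of R "{#}" "{#}" A] by simp

text \<open>If the left \<open>x\<close> is matched to \<open>y\<close> and the right
  \<open>x\<close> to \<open>a\<close>, the assumption on \<open>R\<close> permits matching
  \<open>a\<close> to \<open>y\<close> directly.\<close>

lemma rel_mset_cancel_add: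
  assumes "rel_mset R (add_mset x A) (add_mset x B)"
    and "\<And>a b. R a x \<Longrightarrow> R x b \<Longrightarrow> R a b"
  shows "rel_mset R A B"
proof -
  obtain N y where N: "add_mset x B = add_mset y N" "R x y" "rel_mset R A N"
    using msed_rel_invL[OF assms(1)] by blast
  show ?thesis
  proof (cases "y = x")
    case True
    then show ?thesis using N by simp
  next
    case False
    then obtain C where C: "B = add_mset y C" "N = add_mset x C"
      using N(1) by (metis add_eq_conv_ex)
    then obtain M a where M: "A = add_mset a M" "R a x" "rel_mset R M C"
      using msed_rel_invR N(3) by metis
    then show ?thesis using C N(2) assms(2) by (auto intro: rel_mset_Plus)
  qed
qed

lemma rel_mset_cancel:
  assumes "rel_mset R (L + A) (L + B)"
    and "\<And>x a b. x \<in># L \<Longrightarrow> R a x \<Longrightarrow> R x b \<Longrightarrow> R a b"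
  shows "rel_mset R A B"
  using assms
proof (induction L)
  case (add x L)
  then have "rel_mset R (L + A) (L + B)"
    using rel_mset_cancel_add[of R x "L + A" "L + B"] by auto
  then show ?case using add by auto
qed simp

lemma rel_mset_elemR:
  assumes "rel_mset R D D'" "v \<in># D'"
  obtains u where "u \<in># D" "R u v"
proof -
  have "rel_mset R D (add_mset v (D' - {#v#}))" using assms by simp
  then obtain M u where "D = add_mset u M" "R u v" using msed_rel_invR by metis
  then show thesis using that[of u] by simp
qed

section \<open>Levels of the word tree\<close>

lemma finite_words [simp]: "finite (words m d)"
proof -
  have "words m d = {xs. set xs \<subseteq> {..<m} \<and> length xs \<le> d}" by (auto simp: words_def)
  then show ?thesis by (simp add: finite_lists_length_le)
qed

text \<open>A multiset, because it is added to configurations and subtracted from them as a block of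
  guards.\<close>

definition level :: "nat \<Rightarrow> nat \<Rightarrow> nat list multiset" where
  "level m n = mset_set {u. set u \<subseteq> {..<m} \<and> length u = n}"

lemma finite_level_set [simp]: "finite {u. set u \<subseteq> {..<m::nat} \<and> length u = n}"
  by (simp add: finite_lists_length_eq)

lemma size_level: "size (level m n) = m ^ n"
  using card_lists_length_eq[of "{..<m}" n] by (simp add: level_def)

lemma in_level_iff: "u \<in># level m n \<longleftrightarrow> set u \<subseteq> {..<m} \<and> length u = n"
  by (simp add: level_def)

lemma count_level: "count (level m n) u = (if set u \<subseteq> {..<m} \<and> length u = n then 1 else 0)"
  using finite_level_set[of m n] by (simp add: level_def count_mset_set')

lemma take_words: "u \<in> words m d \<Longrightarrow> take n u \<in> words m n"
  by (auto simp: words_def dest: in_set_takeD)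

lemma words_mono: "d \<le> d' \<Longrightarrow> words m d \<subseteq> words m d'"
  by (auto simp: words_def)

lemma take_in_level: "u \<in> words m d \<Longrightarrow> length u \<ge> n \<Longrightarrow> take n u \<in># level m n"
  by (auto simp: words_def in_level_iff dest: in_set_takeD)

lemma mset_add2: "x \<in># L \<Longrightarrow> y \<in># L \<Longrightarrow> x \<noteq> y \<Longrightarrow> \<exists>M. L = add_mset x (add_mset y M)"
  by (metis multi_member_split insert_noteq_member)

section \<open>Both bounds for increasing the depth by k\<close>

lemma eternal_extend:
  assumes E: "eternal (words m n) (near k) q \<E>"
  shows "\<exists>\<F>. eternal (words m (n + k)) (near k) (m ^ n + q) \<F>"
proof -
  define L where "L = level m n"
  \<comment> \<open>\<open>w\<close> is the one guard that may have left the upper tree; it stands in for its projection.\<close>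
  define \<F> where "\<F> = {L + add_mset w D | w D. w \<in> words m (n + k) \<and> add_mset (take n w) D \<in> \<E>}"
  have sub: "set_mset D \<subseteq> words m n" and sz: "size D = q"
    and att: "\<And>v. v \<in> words m n \<Longrightarrow> \<exists>D'\<in>\<E>. v \<in># D' \<and> rel_mset (near k) D D'" if "D \<in> \<E>" for D
    using E that unfolding eternal_def by auto
  have nil: "[] \<in> words m n" by (simp add: words_def)
  have ne: "\<F> \<noteq> {}"
  proof -
    obtain D where "D \<in> \<E>" using E unfolding eternal_def by auto
    \<comment> \<open>The shape \<open>add_mset (take n w) D\<close> needs a known guard in the
      configuration; an attack on the root provides \<open>[]\<close>.\<close>
    then obtain D' where "D' \<in> \<E>" "[] \<in># D'" using att nil by blast
    then have "L + add_mset [] (D' - {#[]#}) \<in> \<F>"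
      unfolding \<F>_def by (intro CollectI exI[of _ "[]"] exI[of _ "D' - {#[]#}"]) (auto simp: words_def)
    then show ?thesis by auto
  qed
  have main: "\<exists>F'\<in>\<F>. v \<in># F' \<and> rel_mset (near k) (L + add_mset w D) F'"
    if w: "w \<in> words m (n + k)" and D: "add_mset (take n w) D \<in> \<E>" and v: "v \<in> words m (n + k)" for v w D
  proof -
    define x y where "x = take n w" and "y = take n v"
    have wx: "near k w x" and yv: "near k y v"
      using w v near_take_self near_sym unfolding x_def y_def words_def by auto
    have y: "y \<in> words m n" using v take_words unfolding y_def by auto
    have answer: ?thesis
      if "add_mset y D' \<in> \<E>" "rel_mset (near k) (L + add_mset w D) (L + add_mset v D')" for D'
    proof (intro bexI conjI)
      show "L + add_mset v D' \<in> \<F>" using that(1) v unfolding \<F>_def y_def by blast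
      show "v \<in># L + add_mset v D'" by simp
    qed (rule that(2))
    obtain D' where D': "add_mset y D' \<in> \<E>" and r: "rel_mset (near k) (add_mset x D) (add_mset y D')"
      using att[OF D y] unfolding x_def by (metis insert_DiffM)
    \<comment> \<open>Truncation changes only words longer than \<open>n\<close>, and it sends these
      into \<open>L\<close>.\<close>
    have xL: "x = w \<or> x \<in># L" and yL: "y = v \<or> y \<in># L"
      using take_in_level[OF w, of n] take_in_level[OF v, of n] unfolding x_def y_def L_def
      by (cases "length w \<le> n"; cases "length v \<le> n"; simp)+
    \<comment> \<open>The upper move from \<open>add_mset x D\<close> to
      \<open>add_mset y D'\<close> is supplemented by \<open>w\<close> to \<open>x\<close> when
      \<open>x\<close> is in \<open>L\<close>, and by \<open>y\<close> to \<open>v\<close> when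
      \<open>y\<close> is in \<open>L\<close>. The extra \<open>x\<close> or \<open>y\<close> is
      taken from \<open>L\<close>, which contains each vertex only once, so \<open>y = x\<close> is
      a case of its own.\<close>
    consider "x = w" "y = v" | "x = w" "y \<in># L" | "y = v" "x \<in># L" | "x \<in># L" "y \<in># L" "x \<noteq> y"
      | "x \<in># L" "y = x"
      using xL yL by blast
    then show ?thesis
    proof cases
      case 1
      then have "rel_mset (near k) (L + add_mset w D) (L + add_mset v D')"
        using rel_mset_add_refl[OF near_refl r, of L] by simp
      then show ?thesis by (rule answer[OF D'])
    next
      case 2
      then obtain M where "L = add_mset y M" by (metis insert_DiffM)
      moreover have "rel_mset (near k) (M + add_mset y (add_mset x D)) (M + add_mset v (add_mset y D'))"
        by (rule rel_mset_add_refl[OF near_refl rel_mset_Plus[OF yv r]])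
      ultimately have "rel_mset (near k) (L + add_mset w D) (L + add_mset v D')"
        using 2 by (simp add: add_mset_commute)
      then show ?thesis by (rule answer[OF D'])
    next
      case 3
      then obtain M where "L = add_mset x M" by (metis insert_DiffM)
      moreover have "rel_mset (near k) (M + add_mset w (add_mset x D)) (M + add_mset x (add_mset y D'))"
        by (rule rel_mset_add_refl[OF near_refl rel_mset_Plus[OF wx r]])
      ultimately have "rel_mset (near k) (L + add_mset w D) (L + add_mset v D')"
        using 3 by (simp add: add_mset_commute)
      then show ?thesis by (rule answer[OF D'])
    next
      case 4
      then obtain M where "L = add_mset x (add_mset y M)" using mset_add2 by metis
      moreover have "rel_mset (near k) (M + add_mset w (add_mset y (add_mset x D)))
          (M + add_mset x (add_mset v (add_mset y D')))"
        by (rule rel_mset_add_refl[OF near_refl rel_mset_Plus[OF wx rel_mset_Plus[OF yv r]]])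
      ultimately have "rel_mset (near k) (L + add_mset w D) (L + add_mset v D')"
        by (simp add: add_mset_commute)
      then show ?thesis by (rule answer[OF D'])
    next
      case 5
      \<comment> \<open>The upper configuration already contains the attacked projection, so it stays put.\<close>
      then obtain M where "L = add_mset x M" by (metis insert_DiffM)
      moreover have "rel_mset (near k) (M + add_mset w (add_mset x D)) (M + add_mset x (add_mset v D))"
        using yv 5 by (intro rel_mset_add_refl rel_mset_Plus[of "near k" w x] wx
            rel_mset_Plus[of "near k" x v] rel_mset_self) simp_all
      ultimately have "rel_mset (near k) (L + add_mset w D) (L + add_mset v D)"
        by (simp add: add_mset_commute)
      moreover have "add_mset y D \<in> \<E>" using D 5 unfolding x_def by simp
      ultimately show ?thesis by (intro answer)
    qed
  qed
  have "eternal (words m (n + k)) (near k) (m ^ n + q) \<F>"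
    unfolding eternal_def
  proof (intro conjI ballI ne)
    fix F assume "F \<in> \<F>"
    then obtain w D where F: "F = L + add_mset w D" "w \<in> words m (n + k)" "add_mset (take n w) D \<in> \<E>"
      unfolding \<F>_def by auto
    show "set_mset F \<subseteq> words m (n + k)"
      using F sub[OF F(3)] words_mono[of n "n + k" m]
      by (auto simp: L_def in_level_iff words_def)
    show "size F = m ^ n + q"
      using F sz[OF F(3)] by (simp add: L_def size_level)
    fix v assume "v \<in> words m (n + k)"
    then show "\<exists>D'\<in>\<F>. v \<in># D' \<and> rel_mset (near k) F D'" using main F by blast
  qed
  then show ?thesis by blast
qed

text \<open>The bound on \<open>q\<close> accompanies the family because \<open>q - m ^ n\<close> is
  a truncated subtraction.\<close>

lemma eternal_restrict:
  assumes E: "eternal (words m (n + k)) (near k) q \<E>" and m: "m \<ge> 2" and k: "k \<ge> 1"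
  shows "m ^ n \<le> q \<and> (\<exists>\<F>. eternal (words m n) (near k) (q - m ^ n) \<F>)"
proof -
  define L where "L = level m n"
  let ?t = "image_mset (take n)"
  define \<F> where "\<F> = {?t D - L | D. D \<in> \<E>}"
  have sub: "set_mset D \<subseteq> words m (n + k)" and sz: "size D = q"
    and att: "\<And>v. v \<in> words m (n + k) \<Longrightarrow> \<exists>D'\<in>\<E>. v \<in># D' \<and> rel_mset (near k) D D'" if "D \<in> \<E>" for D
    using E that unfolding eternal_def by auto
  have leaf: "x @ replicate k c \<in> words m (n + k)" if "x \<in># L" "c < 2" for x and c :: nat
    using that m by (auto simp: L_def in_level_iff words_def)
  \<comment> \<open>An attack on this leaf is answered from \<open>D\<close>, by a guard that must
    start at or below \<open>x\<close>. The two values of \<open>c\<close> give leaves below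
    different children of \<open>x\<close>.\<close>
  have guard: "\<exists>u \<in># D. take n u = x \<and> near k u (x @ replicate k c)"
    if D: "D \<in> \<E>" and x: "x \<in># L" and c: "c < 2" for D x and c :: nat
  proof -
    obtain D' where D': "x @ replicate k c \<in># D'" "rel_mset (near k) D D'"
      using att[OF D leaf[OF x c]] by blast
    then obtain u where u: "u \<in># D" "near k u (x @ replicate k c)" by (elim rel_mset_elemR)
    then have "take n u = x" using near_leaf_take_eq[OF u(2)] x by (simp add: L_def in_level_iff)
    then show ?thesis using u by blast
  qed
  have Lsub: "L \<subseteq># ?t D" if "D \<in> \<E>" for D
  proof (rule mset_subset_eqI)
    fix x
    show "count L x \<le> count (?t D) x"
    proof (cases "x \<in># L")
      case True
      then have "x \<in># ?t D" using guard[OF that True, of 0] by auto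
      then have "count (?t D) x \<ge> 1" by simp
      then show ?thesis unfolding L_def count_level by auto
    qed (simp add: not_in_iff)
  qed
  have rel: "rel_mset (near k) (?t D - L) (?t D' - L)"
    if "D \<in> \<E>" "D' \<in> \<E>" and r: "rel_mset (near k) D D'" for D D'
  proof -
    \<comment> \<open>The length bounds are carried in the relation because contracting a move
      through \<open>x\<close> in \<open>L\<close> requires both ends to be no deeper than
      \<open>x\<close>.\<close>
    let ?R = "\<lambda>a b. near k a b \<and> length a \<le> n \<and> length b \<le> n"
    have "rel_mset ?R (?t D) (?t D')"
      unfolding multiset.rel_map by (rule multiset.rel_mono_strong[OF r]) (auto intro: near_take)
    then have "rel_mset ?R (L + (?t D - L)) (L + (?t D' - L))"
      using Lsub that by simp
    then have "rel_mset ?R (?t D - L) (?t D' - L)"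
      by (rule rel_mset_cancel) (auto simp: L_def in_level_iff intro: near_trans_deep)
    then show ?thesis by (rule multiset.rel_mono_strong) auto
  qed
  have "\<E> \<noteq> {}" using E unfolding eternal_def by auto
  then obtain D0 where D0: "D0 \<in> \<E>" by auto
  have le: "m ^ n \<le> q"
    using size_mset_mono[OF Lsub[OF D0]] sz[OF D0] by (simp add: L_def size_level)
  have "eternal (words m n) (near k) (q - m ^ n) \<F>"
    unfolding eternal_def
  proof (intro conjI ballI)
    show "\<F> \<noteq> {}" using D0 unfolding \<F>_def by auto
    fix F assume "F \<in> \<F>"
    then obtain D where D: "D \<in> \<E>" "F = ?t D - L" unfolding \<F>_def by auto
    show "set_mset F \<subseteq> words m n"
      using sub[OF D(1)] D(2) by (auto dest!: in_diffD intro!: take_words)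
    show "size F = q - m ^ n"
      using D Lsub[OF D(1)] sz[OF D(1)] by (simp add: size_Diff_submset L_def size_level)
    fix v assume v: "v \<in> words m n"
    have "\<exists>D'\<in>\<E>. v \<in># ?t D' - L \<and> rel_mset (near k) D D'"
    proof (cases "v \<in># L")
      case False
      have "v \<in> words m (n + k)" using v words_mono[of n "n + k" m] by auto
      then obtain D' where D': "D' \<in> \<E>" "v \<in># D'" "rel_mset (near k) D D'"
        using att[OF D(1)] by blast
      have "take n v = v" using v by (simp add: words_def)
      then have "v \<in># ?t D'" using D'(2) by force
      then have "v \<in># ?t D' - L" using False by (metis in_diff_count count_greater_zero_iff not_in_iff)
      then show ?thesis using D' by blast
    next
      case True
      \<comment> \<open>The attack is placed on a leaf below \<open>v\<close>. As \<open>D'\<close>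
        also has a guard near the leaf below another child, \<open>v\<close> occurs at least twice
        in \<open>?t D'\<close> and survives the removal of \<open>L\<close>.\<close>
      let ?w = "v @ replicate k 0"
      obtain D' where D': "D' \<in> \<E>" "?w \<in># D'" "rel_mset (near k) D D'"
        using att[OF D(1) leaf[OF True, of 0]] by auto
      obtain u where u: "u \<in># D'" "take n u = v" "near k u (v @ replicate k 1)"
        using guard[OF D'(1) True, of 1] by auto
      have "u \<noteq> ?w" using u(3) not_near_siblings[OF k] by auto
      then obtain M where M: "D' = add_mset ?w (add_mset u M)" using mset_add2 D'(2) u(1) by metis
      have lv: "length v = n" using True by (simp add: L_def in_level_iff)
      have "count L v < count (?t D') v"
        unfolding L_def count_level M using u(2) lv by simp
      then show ?thesis using D' by (auto simp: in_diff_count)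
    qed
    then show "\<exists>F'\<in>\<F>. v \<in># F' \<and> rel_mset (near k) F F'"
      using rel D unfolding \<F>_def by blast
  qed
  then show ?thesis using le by blast
qed

section \<open>Recursion and closed formula\<close>

definition words_number :: "nat \<Rightarrow> nat \<Rightarrow> nat \<Rightarrow> nat" where
  "words_number m k d = (LEAST q. \<exists>\<E>. eternal (words m d) (near k) q \<E>)"

text \<open>One guard on every vertex, never moving: this ensures that the minimum is
  attained.\<close>

lemma eternal_all: "finite V \<Longrightarrow> (\<And>x. R x x) \<Longrightarrow> eternal V R (card V) {mset_set V}"
  by (auto simp: eternal_def intro: rel_mset_self)

lemma words_number_step:
  assumes "m \<ge> 2" "k \<ge> 1"
  shows "words_number m k (n + k) = m ^ n + words_number m k n"
proof -
  have "\<exists>\<E>. eternal (words m d) (near k) (words_number m k d) \<E>" for d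
    unfolding words_number_def by (rule LeastI) (rule exI, rule eternal_all; simp)
  note ex = this
  have least: "words_number m k d \<le> q" if "eternal (words m d) (near k) q \<E>" for d q \<E>
    unfolding words_number_def using that by (intro Least_le) blast
  have "words_number m k (n + k) \<le> m ^ n + words_number m k n"
    using ex[of n] eternal_extend least by blast
  moreover have "m ^ n + words_number m k n \<le> words_number m k (n + k)"
    using ex[of "n + k"] eternal_restrict[OF _ assms] least by (metis le_diff_conv2 add.commute)
  ultimately show ?thesis by simp
qed

text \<open>Iterating the recursion adds the geometric sum of \<open>m ^ (q + i * k)\<close> over
  \<open>i < j\<close>.\<close>

lemma words_number_formula:
  assumes "m \<ge> 2" "k \<ge> 1"
  shows "real (words_number m k (q + j * k)) =
    (real m ^ (q + j * k) - real m ^ q) / (real m ^ k - 1) + real (words_number m k q)"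
proof (induction j)
  case (Suc j)
  have "real m ^ k > 1" using assms by (intro one_less_power) auto
  moreover have "words_number m k (q + Suc j * k) = m ^ (q + j * k) + words_number m k (q + j * k)"
    using words_number_step[OF assms, of "q + j * k"] by (simp add: algebra_simps)
  ultimately show ?case
    using Suc by (simp add: field_simps power_add)
qed simp

subsection \<open>Walks and distances\<close>


context pair_wf_digraph begin

lemma awalk_cost_one: "awalk_cost (\<lambda>_. 1) p = real (length p)"
  by (induction p) auto

lemma gdist_le_iff: "gdist G u v \<le> ereal (real n) \<longleftrightarrow> (\<exists>p. awalk u p v \<and> length p \<le> n)"
proof
  {
    assume "gdist G u v \<le> ereal (real n)"
    \<comment> \<open>A strict bound on the infimum yields an actual walk, and integrality of its
      length turns \<open>< n + 1\<close> into \<open>\<le> n\<close>.\<close>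
    also have "ereal (real n) < ereal (real n + 1)" by simp
    finally have "(INF p\<in>{p. awalk u p v}. ereal (real (length p))) < ereal (real n + 1)"
      unfolding gdist_def \<mu>_def awalk_cost_one .
    then obtain p where "awalk u p v" "real (length p) < real n + 1"
      unfolding INF_less_iff by auto
    then show "\<exists>p. awalk u p v \<and> length p \<le> n" by (intro exI[of _ p]) auto
  next
    assume "\<exists>p. awalk u p v \<and> length p \<le> n"
    then obtain p where p: "awalk u p v" "length p \<le> n" by blast
    have "gdist G u v \<le> ereal (awalk_cost (\<lambda>_. 1) p)"
      unfolding gdist_def using p(1) by (rule min_cost_le_walk_cost)
    also have "\<dots> \<le> ereal (real n)" using p(2) by (simp add: awalk_cost_one)
    finally show "gdist G u v \<le> ereal (real n)" .
  }
qed

end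

subsection \<open>Coordinates on perfect trees\<close>

locale perfect =
  fixes G :: "'a pair_pre_digraph" and m d :: nat and r :: 'a
  assumes perfect_tree: "perfect_tree m d r G"
begin

lemma pair_graph: "pair_graph G"
  using perfect_tree by (simp add: perfect_tree_def undirected_tree_def)

end

sublocale perfect \<subseteq> pair_graph G
  by (rule pair_graph)

context perfect begin

text \<open>A natural-number version of the distance from the root, to allow induction;
  \<open>gdist_root\<close> links it to \<open>gdist\<close>.\<close>

definition depth :: "'a \<Rightarrow> nat" where
  "depth v = (LEAST n. \<exists>p. awalk r p v \<and> length p = n)"

lemma root_in_verts: "r \<in> pverts G"
  using perfect_tree by (simp add: perfect_tree_def)

lemma awalk_root_ex: "v \<in> pverts G \<Longrightarrow> \<exists>p. awalk r p v"
proof -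
  have "strongly_connected (with_proj G)"
    using perfect_tree symmetric_connected_imp_strongly_connected pair_sym_arcs
    by (simp add: perfect_tree_def undirected_tree_def)
  moreover assume "v \<in> pverts G"
  ultimately have "r \<rightarrow>\<^sup>*\<^bsub>with_proj G\<^esub> v" using root_in_verts by (elim strongly_connectedE) auto
  then show ?thesis by (simp add: reachable_awalk)
qed

lemma depth_awalk:
  assumes "v \<in> pverts G"
  obtains p where "awalk r p v" "length p = depth v"
proof -
  have "\<exists>p. awalk r p v \<and> length p = depth v"
    unfolding depth_def by (rule LeastI_ex) (use awalk_root_ex[OF assms] in auto)
  then show ?thesis using that by blast
qed

lemma depth_le_length: "awalk r p v \<Longrightarrow> depth v \<le> length p"
  unfolding depth_def by (intro Least_le) auto

lemma gdist_root: 
  assumes "v \<in> pverts G"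
  shows "gdist G r v = ereal (real (depth v))"
proof (rule antisym)
  obtain p where p: "awalk r p v" "length p = depth v" using depth_awalk assms .
  then show "gdist G r v \<le> ereal (real (depth v))" by (auto simp: gdist_le_iff)
  show "ereal (real (depth v)) \<le> gdist G r v"
    unfolding gdist_def \<mu>_def by (intro INF_greatest) (auto simp: awalk_cost_one depth_le_length)
qed

lemma depth_root [simp]: "depth r = 0"
  using depth_le_length[of "[]" r] root_in_verts by (simp add: awalk_Nil_iff)

lemma depth_eq_0_iff: "v \<in> pverts G \<Longrightarrow> depth v = 0 \<longleftrightarrow> v = r"
  by (metis depth_awalk depth_root awalk_Nil_iff length_0_conv)

lemma depth_arc: "(u, v) \<in> parcs G \<Longrightarrow> depth v \<le> Suc (depth u)"
proof -
  assume uv: "(u, v) \<in> parcs G"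
  then obtain p where p: "awalk r p u" "length p = depth u" using depth_awalk in_arcsD1 by metis
  have "awalk r (p @ [(u, v)]) v" 
    using p(1) uv by (auto simp: awalk_simps dest: in_arcsD2 in_arcsD1)
  from depth_le_length[OF this] show ?thesis using p(2) by simp
qed

lemma parent_ex:
  assumes "v \<in> pverts G" "depth v = Suc h"
  shows "\<exists>u. (u, v) \<in> parcs G \<and> depth u = h"
proof -
  obtain p where p: "awalk r p v" "length p = depth v" using depth_awalk assms(1) .
  then obtain q e where q: "p = q @ [e]" using assms(2) by (metis length_Suc_conv_rev)
  then obtain u where u: "awalk r q u" "e = (u, v)" "(u, v) \<in> parcs G"
    using p(1) by (cases e) (auto simp: awalk_simps)
  then have "depth u \<le> h" using depth_le_length[OF u(1)] p q assms by simp
  moreover have "h \<le> depth u" using depth_arc[OF u(3)] assms by simp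
  ultimately show ?thesis using u(3) by (intro exI[of _ u]) auto
qed

section \<open>Consequences of acyclicity\<close>

lemma no_long_cycle:
  assumes "awalk u p u" "distinct (tl (awalk_verts u p))"
  shows "length p < 3"
proof (rule ccontr)
  assume "\<not> length p < 3"
  moreover from this have "cycle p" unfolding cycle_def using assms by (intro exI[of _ u]) auto
  ultimately show False
    using perfect_tree by (auto simp: perfect_tree_def undirected_tree_def)
qed

text \<open>Climb from both vertices through parents until the two branches meet. The depth bound
  keeps new vertices off the path, and length at least 2 makes every closure of it a forbidden
  cycle.\<close>

lemma low_path_ex:
  assumes "u \<in> pverts G" "w \<in> pverts G" "depth u = h" "depth w = h" "u \<noteq> w"
  shows "\<exists>p. apath u p w \<and> 2 \<le> length p \<and> (\<forall>x \<in> set (awalk_verts u p). depth x \<le> h)"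
  using assms
proof (induction h arbitrary: u w)
  case 0
  then show ?case using depth_eq_0_iff by metis
next
  case (Suc h)
  obtain u' where u': "(u', u) \<in> parcs G" "depth u' = h" using parent_ex Suc.prems by metis
  obtain w' where w': "(w', w) \<in> parcs G" "depth w' = h" using parent_ex Suc.prems by metis
  have V: "u' \<in> pverts G" "w' \<in> pverts G" using u' w' in_arcsD1 by auto
  have uu: "(u, u') \<in> parcs G" using u' arcs_symmetric by blast
  show ?case
  proof (cases "u' = w'")
    case True
    have "apath u [(u, u'), (w', w)] w"
      using True Suc.prems u' w' V uu by (auto simp: apath_def awalk_simps)
    then show ?thesis
      using Suc.prems u' w' by (intro exI[of _ "[(u, u'), (w', w)]"]) auto
  next
    case False
    then obtain p where p: "apath u' p w'" "2 \<le> length p" "\<forall>x \<in> set (awalk_verts u' p). depth x \<le> h"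
      using Suc.IH[OF V u'(2) w'(2)] by blast
    have aw: "awalk u' p w'" using p(1) by (simp add: apath_def)
    have verts: "awalk_verts u' (p @ [(w', w)]) = awalk_verts u' p @ [w]"
      by (subst awalk_verts_append[where v = w]) (use aw w' Suc.prems V in \<open>auto simp: awalk_simps\<close>)
    have "awalk u ((u, u') # p @ [(w', w)]) w"
      using aw Suc.prems w' uu V by (auto simp: awalk_simps)
    moreover have "u \<notin> set (awalk_verts u' p)" "w \<notin> set (awalk_verts u' p)"
      using p(3) Suc.prems by fastforce+
    ultimately have "apath u ((u, u') # p @ [(w', w)]) w"
      using verts p(1) Suc.prems by (auto simp: apath_def)
    moreover have "\<forall>x \<in> set (awalk_verts u ((u, u') # p @ [(w', w)])). depth x \<le> Suc h"
      using verts p(3) Suc.prems by auto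
    ultimately show ?thesis
      by (intro exI[of _ "(u, u') # p @ [(w', w)]"]) auto
  qed
qed

text \<open>An edge inside a level would close a low path to a cycle of length at least 3.\<close>

lemma depth_arc_neq:
  assumes "(w, u) \<in> parcs G"
  shows "depth u \<noteq> depth w"
proof
  assume h: "depth u = depth w"
  have V: "u \<in> pverts G" "w \<in> pverts G" and "u \<noteq> w"
    using assms in_arcsD1 in_arcsD2 no_loops'[OF assms] by auto
  then obtain p where p: "apath u p w" "2 \<le> length p" using low_path_ex h by metis
  have aw: "awalk u p w" using p(1) by (simp add: apath_def)
  then have c: "awalk u (p @ [(w, u)]) u" using assms V by (auto simp: awalk_simps)
  \<comment> \<open>The closed walk lists \<open>u\<close> first and last; \<open>tl\<close> removes
    the first occurrence.\<close>
  obtain vs where "awalk_verts u p = u # vs"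
    using aw awhd_of_awalk awalk_verts_non_Nil by (metis hd_Cons_tl)
  moreover have "awalk_verts u (p @ [(w, u)]) = awalk_verts u p @ [u]"
    using awalk_verts_append[OF c] aw by simp
  moreover have "distinct (awalk_verts u p)"
    using p(1) by (simp add: apath_def)
  ultimately have "distinct (tl (awalk_verts u (p @ [(w, u)])))" by simp
  then show False using no_long_cycle[OF c] p(2) by simp
qed

text \<open>A low path between two parents closes up through \<open>v\<close>, which is too deep to
  lie on it.\<close>

lemma parent_unique:
  assumes "(u, v) \<in> parcs G" "(w, v) \<in> parcs G" "depth u = h" "depth w = h" "depth v = Suc h"
  shows "u = w"
proof (rule ccontr)
  assume "u \<noteq> w"
  have V: "u \<in> pverts G" "w \<in> pverts G" "v \<in> pverts G"
    using assms in_arcsD1 in_arcsD2 by auto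
  then obtain p where p: "apath u p w" "2 \<le> length p" "\<forall>x \<in> set (awalk_verts u p). depth x \<le> h"
    using low_path_ex assms \<open>u \<noteq> w\<close> by metis
  have aw: "awalk u p w" using p(1) by (simp add: apath_def)
  have vu: "(v, u) \<in> parcs G" using assms arcs_symmetric by blast
  have c: "awalk u (p @ [(w, v), (v, u)]) u" using aw vu assms V by (auto simp: awalk_simps)
  obtain vs where "awalk_verts u p = u # vs"
    using aw awhd_of_awalk awalk_verts_non_Nil by (metis hd_Cons_tl)
  moreover have "awalk_verts u (p @ [(w, v), (v, u)]) = awalk_verts u p @ [v, u]"
    using awalk_verts_append[OF c] aw by simp
  moreover have "distinct (awalk_verts u p)"
    using p(1) by (simp add: apath_def)
  moreover have "v \<notin> set (awalk_verts u p)" using p(3) assms by fastforce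
  ultimately have "distinct (tl (awalk_verts u (p @ [(w, v), (v, u)])))"
    by auto
  then show False using no_long_cycle[OF c] p(2) by simp
qed

lemma mem_children_iff:
  assumes "v \<in> pverts G"
  shows "w \<in> children G r v \<longleftrightarrow> (v, w) \<in> parcs G \<and> depth w = Suc (depth v)"
proof (cases "(v, w) \<in> parcs G")
  case True
  then have "w \<in> pverts G" by (rule in_arcsD2)
  then show ?thesis using True assms by (auto simp: children_def gdist_root)
qed (simp add: children_def)

lemma leaf_depth: "v \<in> pverts G \<Longrightarrow> children G r v = {} \<Longrightarrow> depth v = d"
  using perfect_tree gdist_root[of v] by (auto simp: perfect_tree_def rooted_leaf_def)

text \<open>A vertex of maximal depth has no children, so it is a leaf and has depth
  \<open>d\<close>.\<close>

lemma depth_le: "v \<in> pverts G \<Longrightarrow> depth v \<le> d"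
proof -
  assume v: "v \<in> pverts G"
  have "Max (depth ` pverts G) \<in> depth ` pverts G" using pair_finite_verts v by (intro Max_in) auto
  then obtain x where "x \<in> pverts G" "depth x = Max (depth ` pverts G)" by auto
  then have x: "x \<in> pverts G" "\<forall>y \<in> pverts G. depth y \<le> depth x"
    using pair_finite_verts by auto
  then have "children G r x = {}"
    using mem_children_iff[OF x(1)] in_arcsD2 by fastforce
  then show ?thesis using leaf_depth x v by metis
qed

lemma card_children: "v \<in> pverts G \<Longrightarrow> depth v < d \<Longrightarrow> card (children G r v) = m"
  using perfect_tree gdist_root[of v] by (auto simp: perfect_tree_def rooted_leaf_def)

lemma finite_children: "v \<in> pverts G \<Longrightarrow> finite (children G r v)"
  by (rule finite_subset[OF _ pair_finite_verts]) (auto simp: mem_children_iff dest: in_arcsD2)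

section \<open>Naming vertices by words\<close>

definition child :: "'a \<Rightarrow> nat \<Rightarrow> 'a" where
  "child v = (SOME c. bij_betw c {..<m} (children G r v))"

lemma bij_child:
  assumes "v \<in> pverts G" "depth v < d"
  shows "bij_betw (child v) {..<m} (children G r v)"
proof -
  have "\<exists>c. bij_betw c {..<m} (children G r v)"
    using ex_bij_betw_nat_finite[OF finite_children[OF assms(1)]] card_children[OF assms]
    by (simp add: atLeast0LessThan)
  then show ?thesis unfolding child_def by (rule someI_ex)
qed

definition node :: "nat list \<Rightarrow> 'a" where
  "node u = foldl child r u"

lemma node_Nil [simp]: "node [] = r" and node_snoc: "node (u @ [i]) = child (node u) i"
  by (simp_all add: node_def)

lemma words_snoc: "u @ [i] \<in> words m d \<longleftrightarrow> u \<in> words m d \<and> i < m \<and> length u < d"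
  by (auto simp: words_def)

lemma node_props: "u \<in> words m d \<Longrightarrow> node u \<in> pverts G \<and> depth (node u) = length u"
proof (induction u rule: rev_induct)
  case Nil
  then show ?case using root_in_verts by simp
next
  case (snoc i u)
  then have u: "node u \<in> pverts G" "depth (node u) = length u" "i < m" "length u < d"
    by (auto simp: words_snoc)
  then have "child (node u) i \<in> children G r (node u)"
    using bij_child[of "node u"] by (auto dest: bij_betwE)
  then show ?case
    using u by (auto simp: node_snoc mem_children_iff dest: in_arcsD2)
qed

lemma node_snoc_arc: "u @ [i] \<in> words m d \<Longrightarrow> (node u, node (u @ [i])) \<in> parcs G"
proof -
  assume "u @ [i] \<in> words m d"
  then have u: "u \<in> words m d" "i < m" "length u < d"
    by (auto simp: words_snoc)
  then have "child (node u) i \<in> children G r (node u)"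
    using bij_child[of "node u"] node_props[OF u(1)] by (auto dest: bij_betwE)
  then show ?thesis
    using node_props[OF u(1)] by (auto simp: node_snoc mem_children_iff)
qed

text \<open>Equal nodes have equal depth, hence words of equal length. Unique parents identify the
  prefixes, and injectivity of \<open>child\<close> the last letters.\<close>

lemma node_inj: "u \<in> words m d \<Longrightarrow> v \<in> words m d \<Longrightarrow> node u = node v \<Longrightarrow> u = v"
proof (induction u arbitrary: v rule: rev_induct)
  case Nil
  then show ?case using node_props[of v] by simp
next
  case (snoc i u)
  have "length v = Suc (length u)" using node_props snoc.prems by (metis length_append_singleton)
  then obtain w j where v: "v = w @ [j]" by (metis length_Suc_conv_rev)
  have w: "u \<in> words m d" "w \<in> words m d" "i < m" "j < m" "length u < d"
    using snoc.prems v by (auto simp: words_snoc)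
  have "node u = node w"
    using parent_unique[of "node u" "node v" "node w"] node_snoc_arc[of u i] node_snoc_arc[of w j]
      snoc.prems v node_props[of u] node_props[of w] node_props[of v] w \<open>length v = _\<close> by auto
  moreover from this have "u = w" using snoc.IH w by blast
  moreover have "inj_on (child (node u)) {..<m}"
    using bij_child[of "node u"] node_props[OF w(1)] w by (auto simp: bij_betw_def)
  ultimately show ?case
    using snoc.prems(3) w v by (auto simp: node_snoc inj_on_def)
qed

lemma node_surj: "v \<in> pverts G \<Longrightarrow> v \<in> node ` words m d"
proof (induction "depth v" arbitrary: v)
  case 0
  then have "v = node []" using depth_eq_0_iff by auto
  moreover have "[] \<in> words m d" by (simp add: words_def)
  ultimately show ?case by blast
next
  case (Suc h)
  then obtain x where x: "(x, v) \<in> parcs G" "depth x = h" using parent_ex by metis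
  then have xV: "x \<in> pverts G" using in_arcsD1 by blast
  then obtain u where u: "u \<in> words m d" "x = node u" using Suc.hyps(1) x by blast
  have lt: "depth x < d" using x Suc.hyps(2) depth_le[OF Suc.prems] by simp
  have "v \<in> children G r x" using x xV Suc.hyps(2) by (simp add: mem_children_iff)
  then obtain i where "i < m" "v = child x i"
    using bij_child[OF xV lt] by (auto simp: bij_betw_def)
  then have "v = node (u @ [i])" "u @ [i] \<in> words m d"
    using u(1) lt node_props[OF u(1)] unfolding u(2) by (simp_all add: node_snoc words_snoc)
  then show ?case by blast
qed

lemma bij_node: "bij_betw node (words m d) (pverts G)"
proof (rule bij_betw_imageI)
  show "inj_on node (words m d)" using node_inj by (rule inj_onI)
  show "node ` words m d = pverts G"
    using node_surj by (intro equalityI subsetI) (auto dest: node_props)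
qed

section \<open>Graph distance in coordinates\<close>

lemma node_arcD:
  assumes "(node u, node v) \<in> parcs G" "u \<in> words m d" "v \<in> words m d" "length u \<le> length v"
  shows "\<exists>i. v = u @ [i]"
proof -
  have "length v = Suc (length u)"
    using depth_arc[OF assms(1)] depth_arc_neq[OF assms(1)] node_props[OF assms(2)]
      node_props[OF assms(3)] assms(4) by simp
  then obtain w j where v: "v = w @ [j]" by (metis length_Suc_conv_rev)
  then have w: "w \<in> words m d" using assms(3) by (simp add: words_snoc)
  have "node u = node w"
    using parent_unique[of "node u" "node v" "node w"] node_snoc_arc[of w j] assms(1-3) v
      node_props[of u] node_props[of w] node_props[of v] w \<open>length v = _\<close> by auto
  then show ?thesis using node_inj assms(2) w v by auto
qed

lemma near_arc:
  assumes "near k u v" "(node v, node w) \<in> parcs G" "v \<in> words m d" "w \<in> words m d"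
  shows "near (Suc k) u w"
proof -
  obtain i where i: "i \<le> length u" "i \<le> length v" "take i u = take i v" "length u + length v \<le> k + 2 * i"
    using assms(1) unfolding near_def by auto
  show ?thesis
  proof (cases "length v \<le> length w")
    case True
    then obtain j where "w = v @ [j]" using node_arcD assms by blast
    then show ?thesis using i unfolding near_def by (intro exI[of _ i]) auto
  next
    case False
    then obtain j where v: "v = w @ [j]"
      using node_arcD[of w v] assms arcs_symmetric by auto
    \<comment> \<open>Moving up may cost one letter of the common prefix. Then \<open>2 * i\<close>
      drops by two but the total length only by one, which the extra unit in \<open>Suc k\<close>
      absorbs.\<close>
    have "take (min i (length w)) u = take (min i (length w)) w"
      using arg_cong[OF i(3), of "take (length w)"] v by (simp add: min.commute)
    then show ?thesis
      using i v unfolding near_def by (intro exI[of _ "min i (length w)"]) (auto simp: min_def)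
  qed
qed

lemma awalk_imp_near:
  "awalk (node u) p (node v) \<Longrightarrow> u \<in> words m d \<Longrightarrow> v \<in> words m d \<Longrightarrow> near (length p) u v"
proof (induction p arbitrary: v rule: rev_induct)
  case Nil
  then have "u = v" using node_inj by (simp add: awalk_Nil_iff)
  then show ?case by simp
next
  case (snoc e p)
  then obtain x where x: "awalk (node u) p x" "e = (x, node v)" "(x, node v) \<in> parcs G"
    by (cases e) (auto simp: awalk_simps)
  then obtain w where w: "w \<in> words m d" "x = node w" using node_surj in_arcsD1 by blast
  then show ?case using near_arc[of "length p" u w v] snoc.IH[of w] snoc.prems x by simp
qed

lemma awalk_prefix: "u @ v \<in> words m d \<Longrightarrow> \<exists>p. awalk (node u) p (node (u @ v)) \<and> length p = length v"
proof (induction v rule: rev_induct)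
  case Nil
  then show ?case using node_props by (intro exI[of _ "[]"]) (simp add: awalk_Nil_iff)
next
  case (snoc i v)
  then have uv: "(u @ v) @ [i] \<in> words m d" by simp
  then obtain p where p: "awalk (node u) p (node (u @ v))" "length p = length v"
    using snoc.IH unfolding words_snoc by blast
  have "(node (u @ v), node (u @ v @ [i])) \<in> parcs G" using node_snoc_arc[OF uv] by simp
  then show ?case
    using p by (intro exI[of _ "p @ [(node (u @ v), node (u @ v @ [i]))]"])
      (auto simp: awalk_simps dest: in_arcsD1 in_arcsD2)
qed

text \<open>Walk up from \<open>u\<close> to the common ancestor \<open>take i u\<close>, then down
  to \<open>v\<close>.\<close>

lemma near_imp_awalk:
  assumes "near k u v" "u \<in> words m d" "v \<in> words m d"
  shows "\<exists>p. awalk (node u) p (node v) \<and> length p \<le> k"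
proof -
  obtain i where i: "i \<le> length u" "i \<le> length v" "take i u = take i v" "length u + length v \<le> k + 2 * i"
    using assms(1) unfolding near_def by auto
  obtain p where p: "awalk (node (take i u)) p (node u)" "length p = length u - i"
    using awalk_prefix[of "take i u" "drop i u"] assms(2) by auto
  obtain q where q: "awalk (node (take i v)) q (node v)" "length q = length v - i"
    using awalk_prefix[of "take i v" "drop i v"] assms(3) by auto
  have "awalk (node u) (rev_path p) (node (take i u))" using p(1) by simp
  then have "awalk (node u) (rev_path p @ q) (node v)" using q(1) i(3) by auto
  moreover have "length (rev_path p) = length p" for p :: "('a \<times> 'a) list" by (induction p) auto
  ultimately show ?thesis using p(2) q(2) i by (intro exI[of _ "rev_path p @ q"]) auto
qed

lemma gdist_node:
  assumes "u \<in> words m d" "v \<in> words m d"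
  shows "gdist G (node u) (node v) \<le> ereal (real k) \<longleftrightarrow> near k u v"
proof -
  have "near k u v" if "near j u v" "j \<le> k" for j
    using that unfolding near_def by (meson add_le_mono1 le_trans)
  then show ?thesis
    unfolding gdist_le_iff using awalk_imp_near near_imp_awalk assms by metis
qed

end

section \<open>Transfer to perfect trees\<close>

lemma eternal_image:
  assumes "eternal V R q \<E>" "bij_betw f V V'"
    and "\<And>u v. u \<in> V \<Longrightarrow> v \<in> V \<Longrightarrow> R u v \<Longrightarrow> R' (f u) (f v)"
  shows "eternal V' R' q (image_mset f ` \<E>)"
  unfolding eternal_def
proof (intro conjI ballI)
  show "image_mset f ` \<E> \<noteq> {}" using assms(1) by (auto simp: eternal_def)
  fix F assume "F \<in> image_mset f ` \<E>"
  then obtain D where D: "D \<in> \<E>" "F = image_mset f D" by blast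
  show "set_mset F \<subseteq> V'" "size F = q"
    using D assms(1,2) by (auto simp: eternal_def bij_betw_def)
  fix v' assume "v' \<in> V'"
  then obtain v where v: "v \<in> V" "v' = f v" using assms(2) by (auto simp: bij_betw_def)
  then obtain D' where D': "D' \<in> \<E>" "v \<in># D'" "rel_mset R D D'"
    using assms(1) D unfolding eternal_def by blast
  have "set_mset D \<subseteq> V" "set_mset D' \<subseteq> V" using D(1) D'(1) assms(1) unfolding eternal_def by auto
  then have "rel_mset R' (image_mset f D) (image_mset f D')"
    unfolding multiset.rel_map by (intro multiset.rel_mono_strong[OF D'(3)]) (auto intro: assms(3))
  then show "\<exists>D'\<in>image_mset f ` \<E>. v' \<in># D' \<and> rel_mset R' F D'"
    using D D' v by auto
qed

text \<open>Answering attacks already implies domination. Symmetry enters because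
  \<open>nbhd\<close> measures from the guard and \<open>dist_dominating\<close> from the vertex to
  be guarded.\<close>

lemma eternal_dominating_family_iff:
  assumes sym: "\<And>u v. u \<in> pverts G \<Longrightarrow> v \<in> pverts G \<Longrightarrow>
      gdist G u v \<le> ereal (real k) \<Longrightarrow> gdist G v u \<le> ereal (real k)"
  shows "eternal_dominating_family G k q \<E> \<longleftrightarrow> eternal (pverts G) (\<lambda>u v. v \<in> nbhd G k u) q \<E>"
proof
  assume F: "eternal_dominating_family G k q \<E>"
  show "eternal (pverts G) (\<lambda>u v. v \<in> nbhd G k u) q \<E>"
    unfolding eternal_def
  proof (intro conjI ballI)
    show "\<E> \<noteq> {}" using F by (simp add: eternal_dominating_family_def)
    fix D assume D: "D \<in> \<E>"
    then have "D \<in> dominating_multisets k q G" using F by (auto simp: eternal_dominating_family_def)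
    then show "set_mset D \<subseteq> pverts G" "size D = q"
      by (simp_all add: dominating_multisets_def dist_dominating_def)
    fix v assume "v \<in> pverts G"
    then show "\<exists>D'\<in>\<E>. v \<in># D' \<and> rel_mset (\<lambda>u v. v \<in> nbhd G k u) D D'"
      using F D by (simp add: eternal_dominating_family_def transforms_def)
  qed
next
  assume E: "eternal (pverts G) (\<lambda>u v. v \<in> nbhd G k u) q \<E>"
  have "D \<in> dominating_multisets k q G" if D: "D \<in> \<E>" for D
  proof -
    have sub: "set_mset D \<subseteq> pverts G" and "size D = q" using E D by (simp_all add: eternal_def)
    moreover have "\<exists>u \<in> set_mset D. gdist G v u \<le> ereal (real k)" if v: "v \<in> pverts G" for v
    proof -
      obtain D' where "v \<in># D'" "rel_mset (\<lambda>u v. v \<in> nbhd G k u) D D'"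
        using E D v unfolding eternal_def by blast
      then obtain u where u: "u \<in># D" "v \<in> nbhd G k u" by (elim rel_mset_elemR)
      then have "gdist G u v \<le> ereal (real k)" by (simp add: nbhd_def)
      then show ?thesis using sym[of u v] sub u(1) v by blast
    qed
    ultimately show ?thesis by (simp add: dominating_multisets_def dist_dominating_def)
  qed
  then show "eternal_dominating_family G k q \<E>"
    using E by (auto simp: eternal_dominating_family_def eternal_def transforms_def)
qed

lemma gamma_all_eq_words_number:
  assumes "perfect_tree m d r T"
  shows "gamma_all k T = words_number m k d"
proof -
  interpret perfect T m d r by unfold_locales (rule assms)
  let ?R = "\<lambda>u v. v \<in> nbhd T k u"
  have sym: "gdist T y x \<le> ereal (real k)"
    if xy: "x \<in> pverts T" "y \<in> pverts T" "gdist T x y \<le> ereal (real k)" for x y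
  proof -
    obtain u v where "u \<in> words m d" "v \<in> words m d" "x = node u" "y = node v"
      using node_surj xy by blast
    then show ?thesis using xy(3) gdist_node near_sym by simp
  qed
  have R: "?R (node u) (node v) \<longleftrightarrow> near k u v" if "u \<in> words m d" "v \<in> words m d" for u v
    using that gdist_node node_props by (simp add: nbhd_def)
  have "(\<exists>\<E>. eternal (pverts T) ?R q \<E>) \<longleftrightarrow> (\<exists>\<E>. eternal (words m d) (near k) q \<E>)" for q
  proof
    \<comment> \<open>Families on the tree are pulled back to words along the inverse of
      \<open>node\<close>.\<close>
    let ?g = "inv_into (words m d) node"
    have g: "?g x \<in> words m d" "node (?g x) = x" if "x \<in> pverts T" for x
      using node_surj[OF that] by (auto intro: inv_into_into f_inv_into_f)
    have bij: "bij_betw ?g (pverts T) (words m d)" using bij_node by (rule bij_betw_inv_into)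
    assume "\<exists>\<E>. eternal (pverts T) ?R q \<E>"
    then obtain \<E> where "eternal (pverts T) ?R q \<E>" by blast
    then show "\<exists>\<E>. eternal (words m d) (near k) q \<E>"
      using eternal_image[OF _ bij, of ?R q \<E> "near k"] R g by metis
  next
    assume "\<exists>\<E>. eternal (words m d) (near k) q \<E>"
    then show "\<exists>\<E>. eternal (pverts T) ?R q \<E>"
      using eternal_image[OF _ bij_node, of "near k" q _ ?R] R by blast
  qed
  moreover have "eternal_dominating_family T k q \<E> \<longleftrightarrow> eternal (pverts T) ?R q \<E>" for q \<E>
    using sym by (rule eternal_dominating_family_iff)
  ultimately have iff: "(\<exists>\<E>. eternal_dominating_family T k q \<E>) \<longleftrightarrow>
      (\<exists>\<E>. eternal (words m d) (near k) q \<E>)" for q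
    by simp
  show ?thesis
    unfolding gamma_all_def words_number_def by (intro arg_cong[of _ _ Least] ext) (rule iff)
qed

theorem theorem6:
  fixes T Tq :: "'a pair_pre_digraph" and r :: 'a and m k d q :: nat
  assumes "m \<ge> 2" and "k \<ge> 2"
    and "perfect_tree m d r T"
    and "real d > 3 * real k / 2"
    and "[d = q] (mod k)"
    and "real k / 2 \<le> real q" and "real q < 3 * real k / 2"
    and "subgraph (with_proj Tq) (with_proj T)"
    and "perfect_tree m q r Tq"
  shows "real (gamma_all k T) =
    (real m ^ d - real m ^ q) / (real m ^ k - 1) + real (gamma_all k Tq)"
proof -
  have "q \<le> d" using assms(4,7) by linarith
  then obtain j where "d = q + j * k"
    using assms(5) cong_le_nat[of q d k] cong_sym by (metis add.commute)
  then show ?thesis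
    using words_number_formula[of m k q j] assms(1,2)
      gamma_all_eq_words_number[OF assms(3)] gamma_all_eq_words_number[OF assms(9)] by simp
qed

end
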